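(* For all $\beta \ge \pi$ we have $$\left| I_0(\beta) - \mathbf{L}_0(\beta) - 1 + \frac{2}{\pi}\, \mathrm{Si}(\beta) \right| \le \frac{1}{2},$$ where $\mathbf{L}_0$ denotes the modified Struve function and $\mathrm{Si}$ the sine integral function.
   Context: $I_0$ denotes the modified Bessel function of the first kind of order zero. The modified Struve function is $$\mathbf{L}_0(x) := \sum_{k=0}^\infty \frac{(x/2)^{2k+1}}{\big(\Gamma(k + \frac{3}{2})\big)^2} = \frac{2x}{\pi} \sum_{k=0}^\infty \frac{x^{2k}}{\big((2k+1)!!\big)^2}, \quad x \in \mathbb{R},$$ and the sine integral function is $\mathrm{Si}(x) := \int_0^x \frac{\sin v}{v}\, \mathrm{d}v$, $x \in \mathbb{R}$. *)

theory Defs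
  imports "HOL-Analysis.Analysis" "HOL-Probability.Sinc_Integral"
begin

(* The sine integral is the library's Si from Sinc_Integral. *)

definition bessel_I0 :: "real \<Rightarrow> real" where
  "bessel_I0 x = (\<Sum>k. (x / 2) ^ (2 * k) / (fact k)\<^sup>2)"

definition struve_L0 :: "real \<Rightarrow> real" where
  "struve_L0 x = (\<Sum>k. (x / 2) ^ (2 * k + 1) / (Gamma (real k + 3 / 2))\<^sup>2)"

(* Both series converge for every real argument, so suminf is the genuine sum above. *)

lemma Gamma_half_Suc:
  "Gamma (real (Suc k) + 3 / 2) = (real k + 3 / 2) * Gamma (real k + 3 / 2)"
proof -
  have "real k + 3 / 2 \<notin> \<int>\<^sub>\<le>\<^sub>0"
    using nonpos_Ints_nonpos[of "real k + 3 / 2"] by auto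
  from Gamma_plus1[OF this] show ?thesis by (simp add: add_ac)
qed

lemma Gamma_half_pos: "Gamma (real k + 3 / 2) > 0"
  by (rule Gamma_real_pos) simp

lemma Gamma_half_double_fact:
  "Gamma (real k + 3 / 2) = sqrt pi / 2 ^ (k + 1) * (\<Prod>j\<le>k. 2 * real j + 1)"
proof (induction k)
  case 0
  have "(1 / 2 :: real) \<notin> \<int>\<^sub>\<le>\<^sub>0"
    using nonpos_Ints_nonpos[of "1 / 2 :: real"] by auto
  from Gamma_plus1[OF this] show ?case by (simp add: Gamma_one_half_real)
next
  case (Suc k)
  have "Gamma (real (Suc k) + 3 / 2)
      = (real k + 3 / 2) * (sqrt pi / 2 ^ (k + 1) * (\<Prod>j\<le>k. 2 * real j + 1))"
    by (simp only: Gamma_half_Suc Suc.IH)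
  also have "\<dots> = sqrt pi / 2 ^ (Suc k + 1) * (\<Prod>j\<le>Suc k. 2 * real j + 1)"
    by (simp add: field_simps)
  finally show ?case .
qed

lemma summable_bessel_I0: "summable (\<lambda>k. (x / 2) ^ (2 * k) / (fact k)\<^sup>2 :: real)"
proof (rule summable_comparison_test')
  show "summable (\<lambda>k. ((x / 2)\<^sup>2) ^ k / fact k)"
    using summable_exp[of "(x / 2)\<^sup>2"] by (simp add: field_simps)
  fix k :: nat
  have "(fact k :: real) \<le> (fact k)\<^sup>2"
    by (simp add: power2_eq_square)
  then have "(x / 2) ^ (2 * k) / (fact k)\<^sup>2 \<le> (x / 2) ^ (2 * k) / fact k"
    by (intro divide_left_mono) (auto simp: zero_le_even_power)
  then show "norm ((x / 2) ^ (2 * k) / (fact k)\<^sup>2) \<le> ((x / 2)\<^sup>2) ^ k / fact k"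
    by (simp only: power_mult) (simp add: power_divide)
qed

lemma summable_struve_L0:
  "summable (\<lambda>k. (x / 2) ^ (2 * k + 1) / (Gamma (real k + 3 / 2))\<^sup>2)"
proof (rule summable_ratio_test)
  show "(1 / 2 :: real) < 1" by simp
  fix k assume k: "nat \<lceil>\<bar>x\<bar>\<rceil> \<le> k"
  let ?G = "Gamma (real k + 3 / 2)"
  have "\<bar>x\<bar> \<le> real k + 3 / 2"
    using k by linarith
  then have "\<bar>x\<bar>\<^sup>2 \<le> (real k + 3 / 2)\<^sup>2"
    by (intro power_mono) auto
  then have q: "(x / 2)\<^sup>2 / (real k + 3 / 2)\<^sup>2 \<le> 1 / 2"
    by (simp add: power_divide pos_divide_le_eq) (smt (verit) zero_le_power2)
  have "norm ((x / 2) ^ (2 * Suc k + 1) / (Gamma (real (Suc k) + 3 / 2))\<^sup>2)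
      = norm (((x / 2)\<^sup>2 * (x / 2) ^ (2 * k + 1)) / ((real k + 3 / 2)\<^sup>2 * ?G\<^sup>2))"
    by (simp only: Gamma_half_Suc power_mult_distrib) (simp add: power2_eq_square mult_ac)
  also have "\<dots> = (x / 2)\<^sup>2 / (real k + 3 / 2)\<^sup>2 * norm ((x / 2) ^ (2 * k + 1) / ?G\<^sup>2)"
    by (simp only: times_divide_times_eq [symmetric] norm_mult) simp
  also have "\<dots> \<le> 1 / 2 * norm ((x / 2) ^ (2 * k + 1) / ?G\<^sup>2)"
    by (intro mult_right_mono q) auto
  finally show "norm ((x / 2) ^ (2 * Suc k + 1) / (Gamma (real (Suc k) + 3 / 2))\<^sup>2)
      \<le> 1 / 2 * norm ((x / 2) ^ (2 * k + 1) / ?G\<^sup>2)" .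
qed

(* The second form of the Struve series; the product is the double factorial (2k+1)!!. *)

lemma struve_L0_double_fact:
  "struve_L0 x = 2 * x / pi * (\<Sum>k. x ^ (2 * k) / (\<Prod>j\<le>k. 2 * real j + 1)\<^sup>2)"
proof (cases "x = 0")
  case True
  then show ?thesis by (simp add: struve_L0_def)
next
  case False
  have eq: "(x / 2) ^ (2 * k + 1) / (Gamma (real k + 3 / 2))\<^sup>2
      = 2 * x / pi * (x ^ (2 * k) / (\<Prod>j\<le>k. 2 * real j + 1)\<^sup>2)" for k
    unfolding Gamma_half_double_fact
    by (simp add: power_mult_distrib power_divide power_mult[symmetric] field_simps)
  have "summable (\<lambda>k. 2 * x / pi * (x ^ (2 * k) / (\<Prod>j\<le>k. 2 * real j + 1)\<^sup>2))"
    using summable_struve_L0[of x] by (simp only: eq)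
  then have "summable (\<lambda>k. x ^ (2 * k) / (\<Prod>j\<le>k. 2 * real j + 1)\<^sup>2)"
    using False by (subst (asm) summable_cmult_iff) auto
  then show ?thesis
    unfolding struve_L0_def eq by (rule suminf_mult)
qed

end

theory Submission
  imports Defs
begin

text \<open>
  Both summands of the expression are close to elementary quantities.

  The power series of \<open>I\<^sub>0\<close> and \<open>L\<^sub>0\<close> interleave. Expanding the exponential in
  \<open>2 / pi * \<integral> exp (- \<beta> * sin \<theta>) d\<theta>\<close> over \<open>{0..pi / 2}\<close> and evaluating the resulting Wallis
  integrals of \<open>sin \<theta> ^ n\<close>, the even powers of \<open>\<beta>\<close> give \<open>I\<^sub>0\<close> and the odd ones give
  \<open>- L\<^sub>0\<close> (\<open>bessel_I0_minus_struve_L0\<close>). Neither function separately is small, but the integral shows at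
  once that the difference is nonnegative, and with the chord bound \<open>sin \<theta> \<ge> 2 / pi * \<theta>\<close> it is at most
  \<open>1 / \<beta>\<close> (\<open>bessel_I0_minus_struve_L0_le\<close>).

  For the sine integral, one integration by parts gives
  \<open>\<bar>Si x - (pi / 2 - cos x / x)\<bar> \<le> 1 / x\<close>
  (\<open>Si_le_asymptotic\<close>, \<open>Si_ge_asymptotic\<close>). This suffices for the lower bound everywhere, and for the upper
  bound when \<open>\<beta> \<ge> 2 * pi\<close>. Near \<open>\<beta> = pi\<close> the upper bound is delicate: the two estimates
  \<open>1 / pi \<approx> 0.3183\<close> and \<open>2 / pi * Si pi - 1 \<approx> 0.1790\<close> add up to only slightly less than \<open>1 / 2\<close>.
  On \<open>{pi..2 * pi}\<close> the sine integral decreases, so there it is enough to bound the single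
  number \<open>Si pi\<close> accurately, which a Taylor polynomial does (\<open>Si_pi_le\<close>).
\<close>

section \<open>Wallis integrals\<close>

definition wallis :: "nat \<Rightarrow> real" where
  "wallis n = integral {0..pi / 2} (\<lambda>\<theta>. sin \<theta> ^ n)"

lemma wallis_0: "wallis 0 = pi / 2"
  by (simp add: wallis_def)

lemma wallis_1: "wallis 1 = 1"
proof -
  have "((\<lambda>\<theta>. sin \<theta>) has_integral (- cos (pi / 2) - (- cos 0))) {0..pi / 2}"
    by (rule fundamental_theorem_of_calculus)
       (auto intro!: derivative_eq_intros simp flip: has_real_derivative_iff_has_vector_derivative)
  then show ?thesis
    by (simp add: wallis_def integral_unique)
qed

text \<open>
  The function \<open>cos \<theta> * sin \<theta> ^ (n + 1)\<close> vanishes at both ends of the interval, and after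
  \<open>cos\<^sup>2 = 1 - sin\<^sup>2\<close> its derivative involves only the powers \<open>n\<close> and \<open>n + 2\<close> of the sine.
\<close>

lemma wallis_Suc_Suc: "real (n + 2) * wallis (n + 2) = real (n + 1) * wallis n"
proof -
  have "((\<lambda>\<theta>. real (n + 1) * sin \<theta> ^ n - real (n + 2) * sin \<theta> ^ (n + 2)) has_integral
      (cos (pi / 2) * sin (pi / 2) ^ (n + 1) - cos 0 * sin 0 ^ (n + 1))) {0..pi / 2}"
  proof (rule fundamental_theorem_of_calculus)
    fix \<theta> :: real
    have cos2: "cos \<theta> * cos \<theta> = 1 - sin \<theta> * sin \<theta>"
      using sin_cos_squared_add[of \<theta>] by (simp add: power2_eq_square)
    have "((\<lambda>\<theta>. cos \<theta> * sin \<theta> ^ (n + 1)) has_real_derivative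
        real (n + 1) * sin \<theta> ^ n * (cos \<theta> * cos \<theta>) - sin \<theta> * sin \<theta> ^ (n + 1)) (at \<theta> within {0..pi / 2})"
      by (auto intro!: derivative_eq_intros simp del: power_Suc simp: algebra_simps)
    also have "real (n + 1) * sin \<theta> ^ n * (cos \<theta> * cos \<theta>) - sin \<theta> * sin \<theta> ^ (n + 1)
        = real (n + 1) * sin \<theta> ^ n - real (n + 2) * sin \<theta> ^ (n + 2)"
      unfolding cos2 by (simp add: algebra_simps)
    finally show "((\<lambda>\<theta>. cos \<theta> * sin \<theta> ^ (n + 1)) has_vector_derivative
        real (n + 1) * sin \<theta> ^ n - real (n + 2) * sin \<theta> ^ (n + 2)) (at \<theta> within {0..pi / 2})"
      by (simp only: has_real_derivative_iff_has_vector_derivative)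
  qed simp
  then have "integral {0..pi / 2} (\<lambda>\<theta>. real (n + 1) * sin \<theta> ^ n - real (n + 2) * sin \<theta> ^ (n + 2)) = 0"
    by (simp add: integral_unique)
  moreover have "(\<lambda>\<theta>::real. real m * sin \<theta> ^ k) integrable_on {0..pi / 2}" for m k
    by (intro integrable_continuous_interval continuous_intros)
  ultimately show ?thesis
    by (simp add: wallis_def integral_diff del: of_nat_add of_nat_Suc power_Suc)
qed

text \<open>
  Dividing \<open>wallis n\<close> by \<open>fact n\<close> turns the recurrence into a division by \<open>(n + 2)\<^sup>2\<close>. The coefficients of
  the Bessel series (even \<open>n\<close>) and of the Struve series (odd \<open>n\<close>) satisfy the same recurrence, so
  only the initial values have to be compared.
\<close>

lemma wallis_even: "2 / pi * wallis (2 * k) / fact (2 * k) = 1 / (4 ^ k * (fact k)\<^sup>2)"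
proof (induction k)
  case 0
  then show ?case by (simp add: wallis_0)
next
  case (Suc k)
  have rec: "wallis (2 * k + 2) = real (2 * k + 1) * wallis (2 * k) / real (2 * k + 2)"
    using wallis_Suc_Suc[of "2 * k"] by (simp add: field_simps)
  have "2 / pi * wallis (2 * Suc k) / fact (2 * Suc k)
      = (2 / pi * wallis (2 * k) / fact (2 * k)) / (real (2 * k + 2))\<^sup>2"
  proof -
    have f: "(fact (2 * k + 2) :: real) = real (2 * k + 2) * (real (2 * k + 1) * fact (2 * k))"
      by simp
    have "2 * Suc k = 2 * k + 2" by simp
    then show ?thesis
      by (simp only: rec f) (simp add: power2_eq_square del: of_nat_add of_nat_mult of_nat_Suc)
  qed
  also have "\<dots> = 1 / (4 ^ Suc k * (fact (Suc k))\<^sup>2)"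
    unfolding Suc.IH by (simp add: power2_eq_square field_simps)
  finally show ?case .
qed

lemma wallis_odd:
  "2 / pi * wallis (2 * k + 1) / fact (2 * k + 1) = (1 / 2) ^ (2 * k + 1) / (Gamma (real k + 3 / 2))\<^sup>2"
proof (induction k)
  case 0
  have "(Gamma (real 0 + 3 / 2))\<^sup>2 = pi / 4"
    unfolding Gamma_half_double_fact by (simp add: power_divide)
  then show ?case
    unfolding \<open>(Gamma (real 0 + 3 / 2))\<^sup>2 = pi / 4\<close> by (simp add: wallis_1[simplified])
next
  case (Suc k)
  have rec: "wallis (2 * k + 3) = real (2 * k + 2) * wallis (2 * k + 1) / real (2 * k + 3)"
    using wallis_Suc_Suc[of "2 * k + 1"] by (simp add: field_simps numeral_eq_Suc)
  have "2 / pi * wallis (2 * Suc k + 1) / fact (2 * Suc k + 1)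
      = (2 / pi * wallis (2 * k + 1) / fact (2 * k + 1)) / (real (2 * k + 3))\<^sup>2"
  proof -
    have f: "(fact (2 * k + 3) :: real) = real (2 * k + 3) * (real (2 * k + 2) * fact (2 * k + 1))"
      by (simp add: numeral_eq_Suc)
    have "2 * Suc k + 1 = 2 * k + 3" by simp
    then show ?thesis
      by (simp only: rec f) (simp add: power2_eq_square del: of_nat_add of_nat_mult of_nat_Suc)
  qed
  also have "\<dots> = (1 / 2) ^ (2 * Suc k + 1) / (Gamma (real (Suc k) + 3 / 2))\<^sup>2"
    unfolding Suc.IH Gamma_half_Suc using Gamma_half_pos[of k] by (simp add: power2_eq_square field_simps)
  finally show ?case .
qed

section \<open>An integral for the difference of Bessel and Struve functions\<close>

text \<open>
  Since \<open>\<bar>sin \<theta>\<bar> \<le> 1\<close>, the exponential series in \<open>- \<beta> * sin \<theta>\<close> converges uniformly in \<open>\<theta>\<close>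
  and may be integrated term by term.
\<close>

lemma exp_sin_integral_sums:
  "(\<lambda>n. (- \<beta>) ^ n / fact n * wallis n) sums integral {0..pi / 2} (\<lambda>\<theta>. exp (- \<beta> * sin \<theta>))"
proof -
  let ?f = "\<lambda>n \<theta>. (- \<beta>) ^ n / fact n * sin \<theta> ^ n"
  have exp_series: "(\<lambda>n. ?f n \<theta>) sums exp (- \<beta> * sin \<theta>)" for \<theta>
    using exp_converges[of "- \<beta> * sin \<theta>"] by (simp add: power_mult_distrib[symmetric] field_simps)
  have "uniform_limit {0..pi / 2} (\<lambda>n \<theta>. \<Sum>i<n. ?f i \<theta>) (\<lambda>\<theta>. \<Sum>i. ?f i \<theta>) sequentially"
  proof (rule Weierstrass_m_test)
    show "norm (?f n \<theta>) \<le> inverse (fact n) * \<bar>\<beta>\<bar> ^ n" for n \<theta>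
    proof -
      have "norm (?f n \<theta>) = inverse (fact n) * \<bar>\<beta>\<bar> ^ n * \<bar>sin \<theta>\<bar> ^ n"
        by (simp add: abs_mult power_abs divide_inverse)
      also have "\<dots> \<le> inverse (fact n) * \<bar>\<beta>\<bar> ^ n * 1"
        by (intro mult_left_mono power_le_one) auto
      finally show ?thesis by simp
    qed
    show "summable (\<lambda>n. inverse (fact n) * \<bar>\<beta>\<bar> ^ n)"
      by (rule summable_exp)
  qed
  then have "uniform_limit {0..pi / 2} (\<lambda>n \<theta>. \<Sum>i<n. ?f i \<theta>) (\<lambda>\<theta>. exp (- \<beta> * sin \<theta>)) sequentially"
    using exp_series by (simp add: sums_iff)
  then obtain I J where I: "\<And>n. ((\<lambda>\<theta>. \<Sum>i<n. ?f i \<theta>) has_integral I n) {0..pi / 2}"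
    and J: "((\<lambda>\<theta>. exp (- \<beta> * sin \<theta>)) has_integral J) {0..pi / 2}" and IJ: "I \<longlonglongrightarrow> J"
    by (rule uniform_limit_integral) (auto intro!: continuous_intros)
  have "((\<lambda>\<theta>. \<Sum>i<n. ?f i \<theta>) has_integral (\<Sum>i<n. (- \<beta>) ^ i / fact i * wallis i)) {0..pi / 2}" for n
    unfolding wallis_def
    by (intro has_integral_sum has_integral_mult_right integrable_integral
        integrable_continuous_interval continuous_intros) auto
  then have "I n = (\<Sum>i<n. (- \<beta>) ^ i / fact i * wallis i)" for n
    using I has_integral_unique by blast
  then have "I = (\<lambda>n. \<Sum>i<n. (- \<beta>) ^ i / fact i * wallis i)"
    by (rule ext)
  with IJ integral_unique[OF J] show ?thesis
    by (simp only: sums_def)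
qed

lemma bessel_I0_minus_struve_L0:
  "bessel_I0 \<beta> - struve_L0 \<beta> = 2 / pi * integral {0..pi / 2} (\<lambda>\<theta>. exp (- \<beta> * sin \<theta>))"
proof -
  let ?g = "\<lambda>n. 2 / pi * ((- \<beta>) ^ n / fact n * wallis n)"
  have even: "?g (2 * k) = (\<beta> / 2) ^ (2 * k) / (fact k)\<^sup>2" for k
  proof -
    have "?g (2 * k) = \<beta> ^ (2 * k) * (2 / pi * wallis (2 * k) / fact (2 * k))"
      by simp
    then show ?thesis
      unfolding wallis_even by (simp add: power_divide power_mult)
  qed
  have odd: "?g (2 * k + 1) = - ((\<beta> / 2) ^ (2 * k + 1) / (Gamma (real k + 3 / 2))\<^sup>2)" for k
  proof -
    have "?g (2 * k + 1) = - (\<beta> ^ (2 * k + 1) * (2 / pi * wallis (2 * k + 1) / fact (2 * k + 1)))"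
      by simp
    then show ?thesis
      unfolding wallis_odd by (simp add: power_divide)
  qed
  have "?g sums (2 / pi * integral {0..pi / 2} (\<lambda>\<theta>. exp (- \<beta> * sin \<theta>)))"
    by (intro sums_mult exp_sin_integral_sums)
  \<comment> \<open>Pairing the terms of index \<open>2 * k\<close> and \<open>2 * k + 1\<close> matches the termwise difference of the two
      defining series.\<close>
  from sums_group[OF this, of 2]
  have "(\<lambda>k. sum ?g {k * 2..<k * 2 + 2}) sums (2 / pi * integral {0..pi / 2} (\<lambda>\<theta>. exp (- \<beta> * sin \<theta>)))"
    by simp
  moreover have "sum ?g {k * 2..<k * 2 + 2}
      = (\<beta> / 2) ^ (2 * k) / (fact k)\<^sup>2 - (\<beta> / 2) ^ (2 * k + 1) / (Gamma (real k + 3 / 2))\<^sup>2" for k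
  proof -
    have "{k * 2..<k * 2 + 2} = {2 * k, 2 * k + 1}" by auto
    then have "sum ?g {k * 2..<k * 2 + 2} = ?g (2 * k) + ?g (2 * k + 1)" by simp
    then show ?thesis
      unfolding even odd by simp
  qed
  ultimately have "(\<lambda>k. (\<beta> / 2) ^ (2 * k) / (fact k)\<^sup>2 - (\<beta> / 2) ^ (2 * k + 1) / (Gamma (real k + 3 / 2))\<^sup>2)
      sums (2 / pi * integral {0..pi / 2} (\<lambda>\<theta>. exp (- \<beta> * sin \<theta>)))"
    by (simp only:)
  moreover have "(\<lambda>k. (\<beta> / 2) ^ (2 * k) / (fact k)\<^sup>2 - (\<beta> / 2) ^ (2 * k + 1) / (Gamma (real k + 3 / 2))\<^sup>2)
      sums (bessel_I0 \<beta> - struve_L0 \<beta>)"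
    unfolding bessel_I0_def struve_L0_def
    by (intro sums_diff summable_sums summable_bessel_I0 summable_struve_L0)
  ultimately show ?thesis
    using sums_unique2 by blast
qed

text \<open>Jordan's inequality: the concave sine lies above its chord from \<open>0\<close> to \<open>pi / 2\<close>.\<close>

lemma sin_ge_chord:
  assumes "0 \<le> \<theta>" "\<theta> \<le> pi / 2"
  shows "2 / pi * \<theta> \<le> sin \<theta>"
proof -
  have "concave_on {0..pi / 2} sin"
    by (rule f''_le0_imp_concave[where f' = cos and f'' = "\<lambda>x. - sin x"])
       (auto intro!: derivative_eq_intros sin_ge_zero)
  from concave_onD_Icc[OF this, of "2 / pi * \<theta>"] show ?thesis
    using assms by (simp add: field_simps)
qed

lemma bessel_I0_minus_struve_L0_nonneg: "0 \<le> bessel_I0 \<beta> - struve_L0 \<beta>"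
  unfolding bessel_I0_minus_struve_L0
  by (intro mult_nonneg_nonneg integral_nonneg integrable_continuous_interval continuous_intros) auto

lemma bessel_I0_minus_struve_L0_le:
  assumes "\<beta> > 0"
  shows "bessel_I0 \<beta> - struve_L0 \<beta> \<le> 1 / \<beta>"
proof -
  \<comment> \<open>An antiderivative of \<open>exp (- \<beta> * (2 / pi * \<theta>))\<close>, which dominates the integrand by
      \<open>sin_ge_chord\<close>.\<close>
  let ?E = "\<lambda>\<theta>. - (pi / (2 * \<beta>)) * exp (- \<beta> * (2 / pi * \<theta>))"
  have chord: "((\<lambda>\<theta>. exp (- \<beta> * (2 / pi * \<theta>))) has_integral (?E (pi / 2) - ?E 0)) {0..pi / 2}"
    by (rule fundamental_theorem_of_calculus)
       (use assms in \<open>auto intro!: derivative_eq_intros simp flip: has_real_derivative_iff_has_vector_derivative\<close>)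
  have "((\<lambda>\<theta>. exp (- \<beta> * sin \<theta>)) has_integral integral {0..pi / 2} (\<lambda>\<theta>. exp (- \<beta> * sin \<theta>))) {0..pi / 2}"
    by (intro integrable_integral integrable_continuous_interval continuous_intros)
  then have "integral {0..pi / 2} (\<lambda>\<theta>. exp (- \<beta> * sin \<theta>)) \<le> ?E (pi / 2) - ?E 0"
  proof (rule has_integral_le[OF _ chord])
    fix \<theta> assume "\<theta> \<in> {0..pi / 2}"
    then have "2 / pi * \<theta> \<le> sin \<theta>"
      by (intro sin_ge_chord) auto
    then have "\<beta> * (2 / pi * \<theta>) \<le> \<beta> * sin \<theta>"
      using assms by (intro mult_left_mono) auto
    then show "exp (- \<beta> * sin \<theta>) \<le> exp (- \<beta> * (2 / pi * \<theta>))"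
      by simp
  qed
  also have "\<dots> \<le> pi / (2 * \<beta>)"
    using assms by simp
  finally have "2 / pi * integral {0..pi / 2} (\<lambda>\<theta>. exp (- \<beta> * sin \<theta>)) \<le> 2 / pi * (pi / (2 * \<beta>))"
    by (rule mult_left_mono) simp
  then show ?thesis
    by (simp add: bessel_I0_minus_struve_L0)
qed

section \<open>Bounds for the sine integral\<close>

text \<open>
  The correction \<open>cos x / x\<close> comes from integrating \<open>sin x / x\<close> by parts. The derivative that is left,
  \<open>- cos x / x\<^sup>2\<close>, is dominated in absolute value by the derivative of \<open>1 / x\<close>; hence subtracting
  \<open>1 / x\<close> gives an increasing function and adding it a decreasing one, both tending to \<open>pi / 2\<close>. This is
  how the two asymptotic bounds below arise.
\<close>

lemma Si_plus_cos_div: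
  assumes "x > 0"
  shows "((\<lambda>x. Si x + cos x / x) has_real_derivative (- cos x / x\<^sup>2)) (at x)"
proof -
  have Si': "(Si has_real_derivative sin x / x) (at x)"
    using DERIV_Si[of x] assms by simp
  show ?thesis
    using assms by (auto intro!: derivative_eq_intros Si' simp: power2_eq_square field_simps)
qed

lemma Si_tendsto: "((\<lambda>y. Si y + (cos y + c) / y) \<longlongrightarrow> pi / 2) at_top"
proof -
  have "((\<lambda>y. (cos y + c) / y) \<longlongrightarrow> 0) at_top"
  proof (rule Lim_null_comparison)
    show "\<forall>\<^sub>F y in at_top. norm ((cos y + c) / y) \<le> (1 + \<bar>c\<bar>) / y"
      using eventually_gt_at_top[of 0]
    proof eventually_elim
      case (elim y)
      have "\<bar>cos y + c\<bar> \<le> 1 + \<bar>c\<bar>"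
        using abs_cos_le_one[of y] by linarith
      then show ?case
        using elim by (simp add: divide_right_mono)
    qed
    show "((\<lambda>y. (1 + \<bar>c\<bar>) / y) \<longlongrightarrow> 0) at_top"
      by (intro tendsto_divide_0[OF tendsto_const] filterlim_at_top_imp_at_infinity filterlim_ident)
  qed
  from tendsto_add[OF Si_at_top this] show ?thesis by simp
qed

lemma Si_le_asymptotic:
  assumes "x > 0"
  shows "Si x \<le> pi / 2 + (1 - cos x) / x"
proof -
  have "Si x + (cos x + - 1) / x \<le> pi / 2"
  proof (rule tendsto_lowerbound[OF Si_tendsto])
    show "\<forall>\<^sub>F y in at_top. Si x + (cos x + - 1) / x \<le> Si y + (cos y + - 1) / y"
      using eventually_ge_at_top[of x]
    proof eventually_elim
      case (elim y)
      have "(\<lambda>y. (Si y + cos y / y) - 1 / y) x \<le> (\<lambda>y. (Si y + cos y / y) - 1 / y) y"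
      proof (rule DERIV_nonneg_imp_nondecreasing[OF elim], intro exI conjI)
        fix z assume "x \<le> z" "z \<le> y"
        then have z: "z > 0" using assms by simp
        show "((\<lambda>y. (Si y + cos y / y) - 1 / y) has_real_derivative (- cos z / z\<^sup>2 - (- 1 / z\<^sup>2))) (at z)"
          by (rule DERIV_diff[OF Si_plus_cos_div[OF z]])
             (use z in \<open>auto intro!: derivative_eq_intros simp: power2_eq_square\<close>)
        show "0 \<le> - cos z / z\<^sup>2 - (- 1 / z\<^sup>2)"
          using z by (simp add: field_simps)
      qed
      then show ?case by (simp add: diff_divide_distrib)
    qed
  qed simp
  then show ?thesis by (simp add: diff_divide_distrib)
qed

lemma Si_ge_asymptotic:
  assumes "x > 0"
  shows "pi / 2 - (1 + cos x) / x \<le> Si x"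
proof -
  have "Si x + (cos x + 1) / x \<ge> pi / 2"
  proof (rule tendsto_upperbound[OF Si_tendsto])
    show "\<forall>\<^sub>F y in at_top. Si y + (cos y + 1) / y \<le> Si x + (cos x + 1) / x"
      using eventually_ge_at_top[of x]
    proof eventually_elim
      case (elim y)
      have "(\<lambda>y. (Si y + cos y / y) + 1 / y) y \<le> (\<lambda>y. (Si y + cos y / y) + 1 / y) x"
      proof (rule DERIV_nonpos_imp_nonincreasing[OF elim], intro exI conjI)
        fix z assume "x \<le> z" "z \<le> y"
        then have z: "z > 0" using assms by simp
        show "((\<lambda>y. (Si y + cos y / y) + 1 / y) has_real_derivative (- cos z / z\<^sup>2 + (- 1 / z\<^sup>2))) (at z)"
          by (rule DERIV_add[OF Si_plus_cos_div[OF z]])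
             (use z in \<open>auto intro!: derivative_eq_intros simp: power2_eq_square\<close>)
        have "- 1 \<le> cos z" by simp
        then show "- cos z / z\<^sup>2 + (- 1 / z\<^sup>2) \<le> 0"
          using z by (simp add: field_simps)
      qed
      then show ?case by (simp add: add_divide_distrib)
    qed
  qed simp
  then show ?thesis by (simp add: add_divide_distrib)
qed

lemma sin_le_Taylor9:
  fixes x :: real
  assumes "x \<ge> 0"
  shows "sin x \<le> x - x ^ 3 / 6 + x ^ 5 / 120 - x ^ 7 / 5040 + x ^ 9 / 362880"
proof -
  have "\<bar>sin x - (\<Sum>m<9. sin_coeff m * x ^ m)\<bar> \<le> inverse (fact 9) * \<bar>x\<bar> ^ 9"
    by (rule Maclaurin_sin_bound)
  moreover have "(\<Sum>m<9. sin_coeff m * x ^ m) = x - x ^ 3 / 6 + x ^ 5 / 120 - x ^ 7 / 5040"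
    by (simp add: sin_coeff_def fact_numeral lessThan_nat_numeral)
  moreover have "inverse (fact 9) * \<bar>x\<bar> ^ 9 = x ^ 9 / 362880"
    using assms by (simp add: fact_numeral)
  ultimately show ?thesis
    by linarith
qed

text \<open>The bound for \<open>sin x / x\<close> that follows from \<open>sin_le_Taylor9\<close>, integrated termwise from \<open>0\<close>.\<close>

lemma Si_le_Taylor9:
  assumes "x \<ge> 0"
  shows "Si x \<le> x - x ^ 3 / 18 + x ^ 5 / 600 - x ^ 7 / 35280 + x ^ 9 / 3265920"
proof -
  let ?P = "\<lambda>x::real. x - x ^ 3 / 18 + x ^ 5 / 600 - x ^ 7 / 35280 + x ^ 9 / 3265920"
  have "(\<lambda>x. ?P x - Si x) 0 \<le> (\<lambda>x. ?P x - Si x) x"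
  proof (rule DERIV_nonneg_imp_nondecreasing[OF assms], intro exI conjI)
    fix z :: real assume z: "0 \<le> z" "z \<le> x"
    let ?D = "1 - z ^ 2 / 6 + z ^ 4 / 120 - z ^ 6 / 5040 + z ^ 8 / 362880"
    show "((\<lambda>x. ?P x - Si x) has_real_derivative (?D - sinc z)) (at z)"
      by (rule DERIV_diff[OF _ DERIV_Si]) (auto intro!: derivative_eq_intros)
    show "0 \<le> ?D - sinc z"
    proof (cases "z = 0")
      case False
      have "z * ?D = z - z ^ 3 / 6 + z ^ 5 / 120 - z ^ 7 / 5040 + z ^ 9 / 362880"
        by (simp add: eval_nat_numeral algebra_simps)
      then have "sin z \<le> z * ?D"
        using sin_le_Taylor9[OF z(1)] by simp
      then show ?thesis
        using False z by (simp add: pos_divide_le_eq mult.commute)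
    qed simp
  qed
  moreover have "Si 0 = 0"
    by (simp add: Si_def zero_ereal_def)
  ultimately show ?thesis by simp
qed

text \<open>
  The true value is about \<open>1.85194\<close>. Together with the bound \<open>1 / pi\<close> for \<open>I\<^sub>0 - L\<^sub>0\<close> the final estimate needs
  \<open>Si pi \<le> 3 / 4 * pi - 1 / 2 \<approx> 1.85619\<close>, which leaves little room; degree nine gives about \<open>1.8526\<close>.
\<close>

lemma Si_pi_le: "Si pi \<le> 1.856"
proof -
  have lo: "3.1415 \<le> pi" and hi: "pi \<le> 3.1416"
    using pi_approx by simp_all
  have "(3.1415::real) ^ 3 \<le> pi ^ 3" "(3.1415::real) ^ 7 \<le> pi ^ 7"
    "pi ^ 5 \<le> 3.1416 ^ 5" "pi ^ 9 \<le> 3.1416 ^ 9"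
    using lo hi by (intro power_mono; simp)+
  then have "pi - pi ^ 3 / 18 + pi ^ 5 / 600 - pi ^ 7 / 35280 + pi ^ 9 / 3265920
      \<le> 3.1416 - 3.1415 ^ 3 / 18 + 3.1416 ^ 5 / 600 - 3.1415 ^ 7 / 35280 + 3.1416 ^ 9 / 3265920"
    using hi by (intro add_mono diff_mono divide_right_mono) auto
  also have "\<dots> \<le> 1.856"
    by (simp add: power_divide)
  finally show ?thesis
    using Si_le_Taylor9[of pi] by simp
qed

lemma Si_le_Si_pi:
  assumes "pi \<le> x" "x \<le> 2 * pi"
  shows "Si x \<le> Si pi"
proof (rule DERIV_nonpos_imp_nonincreasing[OF assms(1)], intro exI conjI)
  fix z assume z: "pi \<le> z" "z \<le> x"
  show "(Si has_real_derivative sinc z) (at z)"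
    by (rule DERIV_Si)
  have "0 \<le> sin (z - pi)"
    using z assms by (intro sin_ge_zero) auto
  then have "sin z \<le> 0" by simp
  moreover have "z > 0" using z pi_gt_zero by linarith
  ultimately show "sinc z \<le> 0"
    by (simp add: divide_nonpos_pos)
qed

section \<open>The estimate\<close>

theorem lemma5p1:
  fixes \<beta> :: real
  assumes "\<beta> \<ge> pi"
  shows "\<bar>bessel_I0 \<beta> - struve_L0 \<beta> - 1 + 2 / pi * Si \<beta>\<bar> \<le> 1 / 2"
proof (rule abs_leI)
  let ?D = "bessel_I0 \<beta> - struve_L0 \<beta>"
  have pi3: "pi > 3.14" using pi_approx by simp
  have pos: "\<beta> > 0" using assms pi_gt_zero by linarith
  have D0: "0 \<le> ?D" and D1: "?D \<le> 1 / \<beta>"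
    using bessel_I0_minus_struve_L0_nonneg bessel_I0_minus_struve_L0_le[OF pos] by auto
  \<comment> \<open>Lower bound: the difference is nonnegative, so \<open>Si \<beta> \<ge> pi / 4\<close> is enough.\<close>
  have "(1 + cos \<beta>) / \<beta> \<le> 2 / pi"
    using assms pos by (intro frac_le) auto
  also have "2 / pi \<le> pi / 4"
  proof -
    have "8 \<le> pi * pi" using mult_mono[of 3 pi 3 pi] pi3 by simp
    then show ?thesis by (simp add: field_simps)
  qed
  finally have "pi / 4 \<le> Si \<beta>"
    using Si_ge_asymptotic[OF pos] by linarith
  then have "1 / 2 \<le> 2 / pi * Si \<beta>"
    by (simp add: field_simps)
  then show "- (?D - 1 + 2 / pi * Si \<beta>) \<le> 1 / 2"
    using D0 by linarith
  show "?D - 1 + 2 / pi * Si \<beta> \<le> 1 / 2"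
  proof (cases "\<beta> \<le> 2 * pi")
    case True
    have "2 / pi * Si \<beta> \<le> 2 / pi * 1.856"
      using Si_le_Si_pi[OF assms True] Si_pi_le by (intro mult_left_mono) auto
    moreover have "1 / \<beta> \<le> 1 / pi"
      using assms by (intro divide_left_mono) (auto simp: pos)
    moreover have "1 / pi + 2 / pi * 1.856 \<le> 3 / 2"
      using pi_approx by (simp add: field_simps)
    ultimately show ?thesis using D1 by linarith
  next
    case False
    have "(1 - cos \<beta>) / \<beta> \<le> 2 / (2 * pi)"
      using False pos cos_ge_minus_one[of \<beta>] by (intro frac_le) (auto simp del: cos_ge_minus_one)
    then have "Si \<beta> \<le> pi / 2 + 1 / pi"
      using Si_le_asymptotic[OF pos] by simp
    then have "2 / pi * Si \<beta> \<le> 2 / pi * (pi / 2 + 1 / pi)"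
      by (rule mult_left_mono) simp
    also have "\<dots> = 1 + 2 / pi * (1 / pi)"
      by (simp add: field_simps)
    also have "2 / pi * (1 / pi) \<le> 2 / 3 * (1 / 3)"
      using pi3 by (intro mult_mono divide_left_mono) auto
    moreover have "1 / \<beta> \<le> 1 / 6"
      using False pi3 by (intro divide_left_mono) auto
    ultimately show ?thesis using D1 by linarith
  qed
qed

end
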